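(* Let $k \geq 2$ be an integer and let $q$ be a prime power. Set $c(k,q) := (2 k^2 D_q(k)^2\log q)^{-1}$, where $D_q(k)$ is the sum of the digits of $k$ in base $q$. Let $n \geq 1$ be an integer. If $A \subset P_{q,n}$ is a set with $|A| > 2q^{(1 - c(k,q))n}$, then $A$ contains distinct polynomials $p(T), p'(T)$ such that $p(T) - p'(T) = b(T)^k$ for some $b \in \mathbb{F}_q[T]$.
   Context: For a prime power $q$ and integer $n$, $P_{q,n}$ denotes the $n$-dimensional vector space over $\mathbb{F}_q$ consisting of all polynomials $c_0 + c_1 T + \dots + c_{n-1} T^{n-1}$ with $c_i \in \mathbb{F}_q$ (polynomials in the indeterminate $T$ of degree $< n$). Here $\log$ denotes the natural logarithm. *)

theory Defs
  imports Complex_Main "HOL-Library.Cardinality" "HOL-Computational_Algebra.Computational_Algebra"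
begin

text \<open>The base-\<open>b\<close> digits of \<open>m\<close> are \<open>(m div b ^ i) mod b\<close>.  For \<open>b \<ge> 2\<close> those with
  \<open>i > m\<close> vanish, because \<open>b ^ i > m\<close>, so the sum below runs over all digits.\<close>

definition digit_sum :: "nat \<Rightarrow> nat \<Rightarrow> nat" where
  "digit_sum b m = (\<Sum>i\<le>m. (m div b ^ i) mod b)"

definition c_exponent :: "nat \<Rightarrow> nat \<Rightarrow> real" where
  "c_exponent k q = inverse (2 * (real k)\<^sup>2 * (real (digit_sum q k))\<^sup>2 * ln (real q))"

text \<open>Stated with coefficients rather than \<open>degree\<close>, because the library has
  \<open>degree 0 = 0\<close>.  The coefficient type plays the role of the field with \<open>q = CARD('a)\<close> elements.\<close>

definition polys_below :: "nat \<Rightarrow> 'a :: finite_field poly set" where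
  "polys_below n = {p. \<forall>i\<ge>n. coeff p i = 0}"

end

theory Submission
  imports Defs "HOL-Probability.Hoeffding"
begin

text \<open>
  The argument is the Croot--Lev--Pach polynomial method.  Let \<open>x\<close> range over the coefficient
  vectors of the polynomials \<open>b\<close> with \<open>b ^ k\<close> of degree below \<open>n\<close>, say \<open>m \<ge> n / k\<close> coefficients, and
  let \<open>\<Phi> x\<close> be the vector of the \<open>n\<close> coefficients of \<open>b ^ k\<close>.  By Frobenius, \<open>\<Phi>\<close> is polynomial of
  degree at most \<open>d = D_q(k)\<close>.  Consider
  \<open>K p p' = (\<Sum>x. \<Prod>t<n. 1 - (p_t - p'_t - (\<Phi> x)_t) ^ (q - 1))\<close>,
  which counts, in the field, the \<open>x\<close> with \<open>p - p' = \<Phi> x\<close>.  If \<open>A\<close> has no two distinct elements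
  differing by a \<open>k\<close>-th power, \<open>K\<close> is the identity matrix on \<open>A\<close>.  On the other hand, in the
  expansion of \<open>K\<close> the monomials of degree \<open>r\<close> in \<open>\<Phi> x\<close> sum to zero over \<open>x\<close> unless
  \<open>d r \<ge> (q - 1) m\<close>, so each surviving term has degree at most \<open>(q - 1) (n - m / d) / 2\<close> in \<open>p\<close> or
  in \<open>p'\<close>.  The rank of \<open>K\<close>, hence \<open>|A|\<close>, is at most twice the number of such monomials, which
  Hoeffding's inequality bounds by \<open>q ^ n exp (- m^2 / (2 d^2 n))\<close>.
\<close>

section \<open>Finite fields\<close>

lemma two_le_card_finite_field: "CARD('a :: finite_field) \<ge> 2"
proof -
  have "card {0, 1 :: 'a} \<le> CARD('a)"
    by (intro card_mono) auto
  thus ?thesis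
    by simp
qed

lemma finite_field_power_card_minus_one:
  fixes x :: "'a :: finite_field"
  assumes "x \<noteq> 0"
  shows "x ^ (CARD('a) - 1) = 1"
proof -
  have "x * x ^ (CARD('a) - 1) = x ^ Suc (CARD('a) - 1)"
    by (rule power_Suc[symmetric])
  also have "Suc (CARD('a) - 1) = CARD('a)"
    using two_le_card_finite_field[where 'a = 'a] by linarith
  also have "x ^ CARD('a) = x"
    by (rule finite_field_power_card_eq_same)
  finally show ?thesis
    using assms by simp
qed

text \<open>For \<open>e = 0\<close> every term is 1, also at \<open>t = 0\<close>, and invariance
  of the sum of all elements under translation by 1 shows that \<open>CARD('a)\<close> vanishes in
  the field. For \<open>e > 0\<close>, \<open>X ^ e - 1\<close> has too few roots to kill all units,
  so some unit \<open>c\<close> has \<open>c ^ e \<noteq> 1\<close>; scaling by \<open>c\<close>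
  multiplies the sum by \<open>c ^ e\<close> without changing it.\<close>

lemma sum_power_finite_field_eq_0:
  assumes "e < CARD('a :: finite_field) - 1"
  shows "(\<Sum>t\<in>(UNIV :: 'a set). t ^ e) = 0"
proof (cases "e = 0")
  case True
  have "(\<Sum>t\<in>(UNIV :: 'a set). t) = (\<Sum>t\<in>UNIV. t + 1)"
    by (rule sum.reindex_bij_witness[of _ "\<lambda>t. t + 1" "\<lambda>t. t - 1"]) auto
  thus ?thesis
    using True by (simp add: sum.distrib)
next
  case False
  have "\<exists>c::'a. c \<noteq> 0 \<and> c ^ e \<noteq> 1"
  proof (rule ccontr)
    assume "\<not> ?thesis"
    hence *: "c ^ e = 1" if "c \<noteq> 0" for c :: 'a
      using that by blast
    define p :: "'a poly" where "p = monom 1 e - 1"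
    have "coeff p e = 1"
      using False by (simp add: p_def coeff_1)
    hence "p \<noteq> 0"
      by auto
    have "CARD('a) - 1 = card (UNIV - {0 :: 'a})"
      by simp
    also have "\<dots> \<le> card {x. poly p x = 0}"
      by (intro card_mono) (auto simp: p_def poly_monom *)
    also have "\<dots> \<le> degree p"
      by (rule card_poly_roots_bound) fact
    also have "\<dots> \<le> e"
      unfolding p_def by (intro degree_diff_le degree_monom_le) auto
    finally show False
      using assms by simp
  qed
  then obtain c :: 'a where c: "c \<noteq> 0" "c ^ e \<noteq> 1"
    by blast
  have "(\<Sum>t\<in>(UNIV :: 'a set). t ^ e) = (\<Sum>t\<in>UNIV. (c * t) ^ e)"
    by (rule sum.reindex_bij_witness[of _ "\<lambda>t. c * t" "\<lambda>t. t / c"]) (use c in auto)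
  also have "\<dots> = c ^ e * (\<Sum>t\<in>UNIV. t ^ e)"
    by (simp add: power_mult_distrib sum_distrib_left)
  finally show ?thesis
    using c by simp
qed

text \<open>The polynomial \<open>(X + 1) ^ q - X ^ q - 1\<close> has degree less than \<open>q\<close> but vanishes on the
  whole field.\<close>

lemma of_nat_card_choose_eq_0:
  assumes "0 < i" "i < CARD('a :: finite_field)"
  shows "of_nat (CARD('a) choose i) = (0 :: 'a)"
proof -
  let ?q = "CARD('a)"
  define p :: "'a poly" where "p = (\<Sum>i\<in>{0<..<?q}. monom (of_nat (?q choose i)) i)"
  have "poly p t = 0" for t
  proof -
    have "t + 1 = (t + 1) ^ ?q"
      by (simp add: finite_field_power_card_eq_same)
    also have "\<dots> = (\<Sum>i\<le>?q. of_nat (?q choose i) * t ^ i)"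
      by (simp add: binomial_ring)
    also have "{..?q} = insert 0 (insert ?q {0<..<?q})"
      by auto
    also have "(\<Sum>i\<in>\<dots>. of_nat (?q choose i) * t ^ i) = 1 + (t + poly p t)"
      by (subst sum.insert; (subst sum.insert)?)
        (auto simp: p_def poly_sum poly_monom finite_field_power_card_eq_same)
    finally show ?thesis
      by simp
  qed
  hence roots: "{x. poly p x = 0} = UNIV"
    by simp
  have "p = 0"
  proof (rule ccontr)
    assume "p \<noteq> 0"
    hence "?q \<le> degree p"
      using card_poly_roots_bound[of p] roots by simp
    also have "degree p < ?q"
      unfolding p_def
      by (rule degree_sum_less) (auto intro: le_less_trans[OF degree_monom_le])
    finally show False
      by simp
  qed
  hence "coeff p i = 0"
    by simp
  thus ?thesis
    using assms by (simp add: p_def coeff_sum if_distrib sum.delta cong: if_cong)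
qed

lemma poly_add_power_card:
  fixes x y :: "'a :: finite_field poly"
  shows "(x + y) ^ CARD('a) = x ^ CARD('a) + y ^ CARD('a)"
proof -
  let ?q = "CARD('a)"
  have "(x + y) ^ ?q = (\<Sum>i\<le>?q. of_nat (?q choose i) * x ^ i * y ^ (?q - i))"
    by (rule binomial_ring)
  also have "\<dots> = (\<Sum>i\<in>{0, ?q}. of_nat (?q choose i) * x ^ i * y ^ (?q - i))"
    by (rule sum.mono_neutral_right)
      (auto simp: of_nat_poly of_nat_card_choose_eq_0)
  finally show ?thesis
    by (simp add: add.commute)
qed

lemma poly_sum_power_card:
  fixes f :: "'b \<Rightarrow> 'a :: finite_field poly"
  shows "(\<Sum>i\<in>I. f i) ^ CARD('a) = (\<Sum>i\<in>I. f i ^ CARD('a))"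
  by (induction I rule: infinite_finite_induct) (auto simp: poly_add_power_card power_0_left)

text \<open>Frobenius is additive and fixes each coefficient, so iterating it only stretches the
  exponents of the indeterminate.\<close>

lemma sum_monom_power_card_power:
  fixes x :: "nat \<Rightarrow> 'a :: finite_field"
  shows "(\<Sum>j<m. monom (x j) j) ^ (CARD('a) ^ i) = (\<Sum>j<m. monom (x j) (j * CARD('a) ^ i))"
proof (induction i)
  case (Suc i)
  have "(\<Sum>j<m. monom (x j) j) ^ (CARD('a) ^ Suc i) =
      ((\<Sum>j<m. monom (x j) j) ^ (CARD('a) ^ i)) ^ CARD('a)"
    by (simp add: power_mult[symmetric] mult.commute)
  thus ?case
    by (simp add: Suc poly_sum_power_card monom_power finite_field_power_card_eq_same mult_ac)
qed auto

section \<open>Polynomial functions of bounded total degree\<close>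

text \<open>Functions given by polynomials in \<open>x 0, ..., x (m - 1)\<close> of total degree at
  most \<open>d\<close>. Building them monomial by monomial reduces claims linear in the function to
  single monomials; exponents need not be reduced below \<open>q\<close>.\<close>

inductive poly_fun :: "nat \<Rightarrow> nat \<Rightarrow> ((nat \<Rightarrow> 'a :: comm_ring_1) \<Rightarrow> 'a) \<Rightarrow> bool" for m d where
  zero: "poly_fun m d (\<lambda>x. 0)"
| add_monom: "poly_fun m d f \<Longrightarrow> (\<Sum>i<m. e i) \<le> d \<Longrightarrow>
    poly_fun m d (\<lambda>x. f x + c * (\<Prod>i<m. x i ^ e i))"

lemma poly_fun_add:
  assumes "poly_fun m d f" "poly_fun m d g"
  shows "poly_fun m d (\<lambda>x. f x + g x)"
  using assms(2)
proof (induction rule: poly_fun.induct)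
  case (add_monom g e c)
  have "poly_fun m d (\<lambda>x. (f x + g x) + c * (\<Prod>i<m. x i ^ e i))"
    using add_monom by (intro poly_fun.intros)
  thus ?case
    by (simp add: add.assoc)
qed (use assms in auto)

lemma poly_fun_monom:
  assumes "(\<Sum>i<m. e i) \<le> d"
  shows "poly_fun m d (\<lambda>x. c * (\<Prod>i<m. x i ^ e i))"
  using poly_fun.add_monom[OF poly_fun.zero assms] by simp

lemma poly_fun_const: "poly_fun m d (\<lambda>x. c)"
  using poly_fun_monom[of "\<lambda>_. 0" m d c] by simp

lemma poly_fun_var:
  assumes "i < m"
  shows "poly_fun m 1 (\<lambda>x. x i)"
proof -
  have "poly_fun m 1 (\<lambda>x. 1 * (\<Prod>j<m. x j ^ (if j = i then 1 else 0)))"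
    by (rule poly_fun_monom) simp
  also have "(\<lambda>x :: nat \<Rightarrow> 'a. 1 * (\<Prod>j<m. x j ^ (if j = i then 1 else 0))) = (\<lambda>x. x i)"
    using assms by (auto simp: if_distrib[of "\<lambda>e. _ ^ e"] prod.delta cong: if_cong)
  finally show ?thesis .
qed

lemma poly_fun_mult_monom:
  assumes "poly_fun m d f" "(\<Sum>i<m. e i) \<le> d'"
  shows "poly_fun m (d + d') (\<lambda>x. f x * (c * (\<Prod>i<m. x i ^ e i)))"
  using assms(1)
proof (induction rule: poly_fun.induct)
  case zero
  show ?case
    using poly_fun.zero by simp
next
  case (add_monom f e' c')
  have "poly_fun m (d + d') (\<lambda>x. f x * (c * (\<Prod>i<m. x i ^ e i)) +
      c' * c * (\<Prod>i<m. x i ^ (e' i + e i)))"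
    using add_monom assms(2) by (intro poly_fun.intros) (auto simp: sum.distrib)
  thus ?case
    by (simp add: algebra_simps power_add prod.distrib)
qed

lemma poly_fun_mult:
  assumes "poly_fun m d f" "poly_fun m d' g"
  shows "poly_fun m (d + d') (\<lambda>x. f x * g x)"
  using assms(2)
proof (induction rule: poly_fun.induct)
  case zero
  show ?case
    using poly_fun.zero by simp
next
  case (add_monom g e c)
  have "poly_fun m (d + d') (\<lambda>x. f x * g x + f x * (c * (\<Prod>i<m. x i ^ e i)))"
    using add_monom assms(1) by (intro poly_fun_add poly_fun_mult_monom)
  thus ?case
    by (simp add: distrib_left)
qed

lemma poly_fun_sum:
  assumes "\<And>i. i \<in> I \<Longrightarrow> poly_fun m d (f i)"
  shows "poly_fun m d (\<lambda>x. \<Sum>i\<in>I. f i x)"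
  using assms
  by (induction I rule: infinite_finite_induct) (auto intro: poly_fun_add poly_fun.zero)

lemma poly_fun_prod:
  assumes "\<And>i. i \<in> I \<Longrightarrow> poly_fun m (d i) (f i)"
  shows "poly_fun m (\<Sum>i\<in>I. d i) (\<lambda>x. \<Prod>i\<in>I. f i x)"
  using assms
  by (induction I rule: infinite_finite_induct) (auto intro: poly_fun_mult poly_fun_const)

lemma poly_fun_power:
  assumes "poly_fun m d f"
  shows "poly_fun m (d * r) (\<lambda>x. f x ^ r)"
  using poly_fun_prod[of "{..<r}" m "\<lambda>_. d" "\<lambda>_. f"] assms by (simp add: mult.commute)

text \<open>The argument of Chevalley and Warning: the sum of a monomial factors into one-variable
  power sums, and by the degree bound some exponent is below \<open>q - 1\<close>, so its factor
  vanishes.\<close>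

lemma sum_poly_fun_eq_0:
  fixes f :: "(nat \<Rightarrow> 'a :: finite_field) \<Rightarrow> 'a"
  assumes "poly_fun m d f" "d < (CARD('a) - 1) * m"
  shows "(\<Sum>x\<in>{..<m} \<rightarrow>\<^sub>E UNIV. f x) = 0"
  using assms(1)
proof (induction rule: poly_fun.induct)
  case (add_monom f e c)
  have "\<exists>i<m. e i < CARD('a) - 1"
  proof (rule ccontr)
    assume "\<not> ?thesis"
    hence "(\<Sum>i<m. CARD('a) - 1) \<le> (\<Sum>i<m. e i)"
      by (intro sum_mono) auto
    thus False
      using add_monom assms(2) by (simp add: mult.commute)
  qed
  then obtain i where i: "i < m" "e i < CARD('a) - 1"
    by blast
  have "(\<Sum>x\<in>{..<m} \<rightarrow>\<^sub>E (UNIV :: 'a set). \<Prod>i<m. x i ^ e i) = (\<Prod>i<m. \<Sum>t\<in>UNIV. t ^ e i)"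
    by (subst prod_sum_PiE) auto
  also have "\<dots> = 0"
    using i sum_power_finite_field_eq_0 by (intro prod_zero) auto
  finally show ?case
    using add_monom by (simp add: sum.distrib sum_distrib_left[symmetric])
qed auto

section \<open>Powers and base-q digits\<close>

lemma sum_digits_lessThan: "(\<Sum>i<r. (k div b ^ i mod b) * b ^ i) = k mod b ^ (r :: nat)" for k b :: nat
proof (induction r)
  case (Suc r)
  have "k mod (b ^ r * b) = b ^ r * (k div b ^ r mod b) + k mod b ^ r"
    by (rule mod_mult2_eq)
  thus ?case
    using Suc by (simp add: mult_ac)
qed auto

lemma sum_digits:
  assumes "b \<ge> 2"
  shows "(\<Sum>i\<le>k. (k div b ^ i mod b) * b ^ i) = (k :: nat)"
proof -
  have "k < 2 ^ k"
    by simp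
  also have "\<dots> \<le> b ^ k"
    using assms by (intro power_mono) auto
  also have "\<dots> \<le> b ^ Suc k"
    using assms by (intro power_increasing) auto
  finally show ?thesis
    using sum_digits_lessThan[where r = "Suc k" and k = k and b = b]
    by (simp add: lessThan_Suc_atMost)
qed

lemma digit_sum_pos:
  assumes "b \<ge> 2" "k > 0"
  shows "digit_sum b k > 0"
proof (rule ccontr)
  assume "\<not> ?thesis"
  hence "\<forall>i\<le>k. k div b ^ i mod b = 0"
    by (simp add: digit_sum_def)
  hence "(\<Sum>i\<le>k. (k div b ^ i mod b) * b ^ i) = 0"
    by simp
  thus False
    using assms sum_digits[of b k] by simp
qed

lemma poly_fun_coeff_mult:
  assumes "\<And>t. poly_fun m d (\<lambda>x. coeff (F x) t)" "\<And>t. poly_fun m d' (\<lambda>x. coeff (G x) t)"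
  shows "poly_fun m (d + d') (\<lambda>x. coeff (F x * G x) t)"
  unfolding coeff_mult by (intro poly_fun_sum poly_fun_mult assms)

lemma poly_fun_coeff_prod:
  assumes "\<And>i t. i \<in> I \<Longrightarrow> poly_fun m (d i) (\<lambda>x. coeff (F i x) t)"
  shows "poly_fun m (\<Sum>i\<in>I. d i) (\<lambda>x. coeff (\<Prod>i\<in>I. F i x) t)"
  using assms
proof (induction I arbitrary: t rule: infinite_finite_induct)
  case (insert i I)
  show ?case
    using insert by (simp add: poly_fun_coeff_mult)
qed (auto intro: poly_fun_const)

lemma poly_fun_coeff_power:
  assumes "\<And>t. poly_fun m d (\<lambda>x. coeff (F x) t)"
  shows "poly_fun m (d * r) (\<lambda>x. coeff (F x ^ r) t)"
  using poly_fun_coeff_prod[of "{..<r}" m "\<lambda>_. d" "\<lambda>_. F"] assms by (simp add: mult.commute)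

text \<open>Frobenius makes the coefficients of \<open>b ^ (q ^ i)\<close> linear in those of \<open>b\<close>, so each
  base-\<open>q\<close> digit of \<open>k\<close> contributes only its own value to the degree.\<close>

lemma poly_fun_coeff_power_digit_sum:
  "poly_fun m (digit_sum CARD('a) k)
     (\<lambda>x :: nat \<Rightarrow> 'a :: finite_field. coeff ((\<Sum>j<m. monom (x j) j) ^ k) t)"
proof -
  let ?q = "CARD('a)"
  have lin: "poly_fun m 1 (\<lambda>x :: nat \<Rightarrow> 'a. coeff ((\<Sum>j<m. monom (x j) j) ^ (?q ^ i)) t)" for i t
    unfolding sum_monom_power_card_power coeff_sum coeff_monom
  proof (rule poly_fun_sum)
    show "poly_fun m 1 (\<lambda>x :: nat \<Rightarrow> 'a. if j * ?q ^ i = t then x j else 0)" if "j \<in> {..<m}" for j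
      using that poly_fun_var[of j m] poly_fun.zero by (cases "j * ?q ^ i = t") auto
  qed
  have "(\<lambda>x :: nat \<Rightarrow> 'a. (\<Sum>j<m. monom (x j) j) ^ k) =
      (\<lambda>x. \<Prod>i\<le>k. ((\<Sum>j<m. monom (x j) j) ^ (?q ^ i)) ^ (k div ?q ^ i mod ?q))"
    using sum_digits[OF two_le_card_finite_field[where 'a = 'a], of k]
    by (simp add: power_sum[symmetric] power_mult[symmetric] mult.commute)
  moreover have "poly_fun m (\<Sum>i\<le>k. 1 * (k div ?q ^ i mod ?q))
      (\<lambda>x :: nat \<Rightarrow> 'a. coeff (\<Prod>i\<le>k. ((\<Sum>j<m. monom (x j) j) ^ (?q ^ i)) ^ (k div ?q ^ i mod ?q)) t)"
    by (intro poly_fun_coeff_prod poly_fun_coeff_power lin)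
  ultimately show ?thesis
    by (simp add: digit_sum_def fun_eq_iff)
qed

section \<open>The rank argument\<close>

text \<open>Instead of linear algebra: every function on \<open>A\<close> is determined by \<open>card I\<close> field elements,
  so one compares the numbers of functions.\<close>

lemma card_le_of_identity_factorization:
  fixes g h :: "'i \<Rightarrow> 'b \<Rightarrow> 'a :: finite_field"
  assumes "finite A" "finite I"
    and id: "\<And>a b. a \<in> A \<Longrightarrow> b \<in> A \<Longrightarrow> (\<Sum>i\<in>I. g i a * h i b) = (if a = b then 1 else 0)"
  shows "card A \<le> card I"
proof -
  \<comment> \<open>The pairings of \<open>f\<close> with the \<open>g i\<close>; by hypothesis
    \<open>id\<close>, pairing them in turn with the \<open>h i\<close> recovers \<open>f\<close> on
    \<open>A\<close>.\<close>
  define T where "T f = (\<lambda>i\<in>I. \<Sum>a\<in>A. f a * g i a)" for f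
  have T: "f b = (\<Sum>i\<in>I. T f i * h i b)" if "b \<in> A" for f b
  proof -
    have "(\<Sum>i\<in>I. T f i * h i b) = (\<Sum>i\<in>I. \<Sum>a\<in>A. f a * (g i a * h i b))"
      by (simp add: T_def sum_distrib_left sum_distrib_right mult_ac)
    also have "\<dots> = (\<Sum>a\<in>A. f a * (\<Sum>i\<in>I. g i a * h i b))"
      by (subst sum.swap) (simp add: sum_distrib_left)
    also have "\<dots> = (\<Sum>a\<in>A. f a * (if a = b then 1 else 0))"
      using id that by (intro sum.cong) auto
    also have "\<dots> = f b"
      using that \<open>finite A\<close> by (simp add: if_distrib sum.delta cong: if_cong)
    finally show ?thesis ..
  qed
  have "inj_on T (A \<rightarrow>\<^sub>E UNIV)"
  proof (rule inj_onI)
    fix f f' assume ff': "f \<in> A \<rightarrow>\<^sub>E UNIV" "f' \<in> A \<rightarrow>\<^sub>E UNIV" "T f = T f'"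
    thus "f = f'"
      using T[of _ f] T[of _ f'] by (intro PiE_ext[OF ff'(1,2)]) auto
  qed
  moreover have "T ` (A \<rightarrow>\<^sub>E UNIV) \<subseteq> I \<rightarrow>\<^sub>E UNIV"
    by (auto simp: T_def)
  ultimately have "card (A \<rightarrow>\<^sub>E (UNIV :: 'a set)) \<le> card (I \<rightarrow>\<^sub>E (UNIV :: 'a set))"
    using \<open>finite I\<close> by (intro card_inj_on_le finite_PiE) auto
  hence "CARD('a) ^ card A \<le> CARD('a) ^ card I"
    using assms by (simp add: card_PiE)
  thus ?thesis
    using two_le_card_finite_field[where 'a = 'a] by (subst (asm) power_increasing_iff) auto
qed

text \<open>Terms sharing the same left factor \<open>u l\<close> combine into a single product, and
  likewise on the right. Every term of nonzero weight falls into such a group with \<open>l\<close>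
  in \<open>L\<close>, so the matrix has rank at most \<open>2 * card L\<close>.\<close>

lemma card_le_of_low_rank_terms:
  fixes u :: "'l \<Rightarrow> 'b \<Rightarrow> 'a :: finite_field"
  assumes "finite A" "finite L" "finite S"
    and low: "\<And>s. s \<in> S \<Longrightarrow> w s \<noteq> 0 \<Longrightarrow> \<alpha> s \<in> L \<or> \<beta> s \<in> L"
    and id: "\<And>a b. a \<in> A \<Longrightarrow> b \<in> A \<Longrightarrow>
      (\<Sum>s\<in>S. w s * u (\<alpha> s) a * u (\<beta> s) b) = (if a = b then 1 else 0)"
  shows "card A \<le> 2 * card L"
proof -
  define S1 where "S1 = {s \<in> S. \<alpha> s \<in> L}"
  define S2 where "S2 = {s \<in> S. \<alpha> s \<notin> L \<and> \<beta> s \<in> L}"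
  \<comment> \<open>The Boolean tag tells whether \<open>u l\<close> is the left factor
    (\<open>True\<close>, terms of \<open>S1\<close>) or the right one (\<open>False\<close>, terms
    of \<open>S2\<close>).\<close>
  define g where "g = (\<lambda>(l, c) a. if c then u l a else \<Sum>s\<in>{s \<in> S2. \<beta> s = l}. w s * u (\<alpha> s) a)"
  define h where "h = (\<lambda>(l, c) b. if c then \<Sum>s\<in>{s \<in> S1. \<alpha> s = l}. w s * u (\<beta> s) b else u l b)"
  have fin: "finite S1" "finite S2"
    using \<open>finite S\<close> by (auto simp: S1_def S2_def)
  have split: "(\<Sum>s\<in>S. w s * u (\<alpha> s) a * u (\<beta> s) b) = (\<Sum>i\<in>L \<times> UNIV. g i a * h i b)" for a b
  proof -
    let ?f = "\<lambda>s. w s * u (\<alpha> s) a * u (\<beta> s) b"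
    have "sum ?f S = sum ?f (S1 \<union> S2)"
      using \<open>finite S\<close> low by (intro sum.mono_neutral_right) (auto simp: S1_def S2_def)
    also have "\<dots> = sum ?f S1 + sum ?f S2"
      by (intro sum.union_disjoint fin) (auto simp: S1_def S2_def)
    also have "sum ?f S1 = (\<Sum>l\<in>L. \<Sum>s\<in>{s \<in> S1. \<alpha> s = l}. ?f s)"
      using fin \<open>finite L\<close> by (intro sum.group[symmetric]) (auto simp: S1_def)
    also have "\<dots> = (\<Sum>l\<in>L. g (l, True) a * h (l, True) b)"
      by (simp add: g_def h_def sum_distrib_left mult_ac)
    also have "sum ?f S2 = (\<Sum>l\<in>L. \<Sum>s\<in>{s \<in> S2. \<beta> s = l}. ?f s)"
      using fin \<open>finite L\<close> by (intro sum.group[symmetric]) (auto simp: S2_def)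
    also have "\<dots> = (\<Sum>l\<in>L. g (l, False) a * h (l, False) b)"
      by (simp add: g_def h_def sum_distrib_right)
    finally show ?thesis
      by (simp add: sum.cartesian_product' UNIV_bool sum.distrib add.commute)
  qed
  have "card A \<le> card (L \<times> (UNIV :: bool set))"
    using id \<open>finite L\<close>
    by (intro card_le_of_identity_factorization[where g = g and h = h] \<open>finite A\<close>)
       (auto simp: split)
  thus ?thesis
    by (simp add: card_cartesian_product)
qed

section \<open>Expanding the indicator of zero\<close>

text \<open>Exponents in the expansion of \<open>1 - (u - v - w) ^ N\<close>: the power is
  homogeneous of degree \<open>N\<close>, and the inequality makes room for the constant 1.\<close>

definition exponent_triples :: "nat \<Rightarrow> (nat \<times> nat \<times> nat) set" where
  "exponent_triples N = {(i, j, l). i + j + l \<le> N}"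

lemma finite_exponent_triples: "finite (exponent_triples N)"
  by (rule finite_subset[of _ "{..N} \<times> {..N} \<times> {..N}"]) (auto simp: exponent_triples_def)

text \<open>The coefficients are chosen before \<open>u\<close>, \<open>v\<close>, \<open>w\<close>,
  so one family \<open>c\<close> serves all coordinates and all points.\<close>

lemma one_minus_power_expansion:
  "\<exists>c. \<forall>u v w :: 'a :: comm_ring_1. 1 - (u - v - w) ^ N =
     (\<Sum>(i, j, l)\<in>exponent_triples N. c (i, j, l) * u ^ i * v ^ j * w ^ l)"
proof -
  \<comment> \<open>The constant 1 minus the signed trinomial coefficient, the latter written as a
    product of two binomials from expanding twice.\<close>
  define c :: "nat \<times> nat \<times> nat \<Rightarrow> 'a" where
    "c = (\<lambda>(i, j, l). (if (i, j, l) = (0, 0, 0) then 1 else 0) -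
       (if i + j + l = N then of_nat (N choose l) * of_nat ((i + j) choose j) * (-1) ^ (j + l) else 0))"
  have "1 - (u - v - w) ^ N =
     (\<Sum>(i, j, l)\<in>exponent_triples N. c (i, j, l) * u ^ i * v ^ j * w ^ l)" for u v w :: 'a
  proof -
    let ?t = "\<lambda>(i, j, l). of_nat (N choose l) * of_nat ((i + j) choose j) * (-1) ^ (j + l) *
      u ^ i * v ^ j * w ^ l"
    have "(u - v - w) ^ N = ((-w) + ((-v) + u)) ^ N"
      by (simp add: algebra_simps)
    also have "\<dots> = (\<Sum>l\<le>N. \<Sum>j\<le>N-l. of_nat (N choose l) * (-w) ^ l *
        (of_nat ((N - l) choose j) * (-v) ^ j * u ^ (N - l - j)))"
      by (simp only: binomial_ring[of "-w"] binomial_ring[of "-v"] sum_distrib_left)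
    also have "\<dots> = (\<Sum>(l, j)\<in>Sigma {..N} (\<lambda>l. {..N-l}). of_nat (N choose l) * (-w) ^ l *
        (of_nat ((N - l) choose j) * (-v) ^ j * u ^ (N - l - j)))"
      by (subst sum.Sigma) auto
    also have "\<dots> = sum ?t {(i, j, l). i + j + l = N}"
      by (rule sum.reindex_bij_witness[of _ "\<lambda>(i, j, l). (l, j)" "\<lambda>(l, j). (N - l - j, j, l)"])
        (auto simp: power_add power_minus[of v] power_minus[of w] mult_ac)
    also have "\<dots> = (\<Sum>s\<in>exponent_triples N. case s of (i, j, l) \<Rightarrow>
        if i + j + l = N then ?t (i, j, l) else 0)"
      by (rule sum.mono_neutral_cong_left)
        (auto simp: finite_exponent_triples, auto simp: exponent_triples_def split: if_splits)
    finally have *: "(u - v - w) ^ N = \<dots>" .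
    have zero_triple: "(0, 0, 0) \<in> exponent_triples N"
      by (simp add: exponent_triples_def)
    have "(1 :: 'a) = (\<Sum>s\<in>exponent_triples N. if s = (0, 0, 0) then 1 else 0)"
      using zero_triple by (simp add: finite_exponent_triples)
    also have "\<dots> - (u - v - w) ^ N =
        (\<Sum>(i, j, l)\<in>exponent_triples N. c (i, j, l) * u ^ i * v ^ j * w ^ l)"
      unfolding * sum_subtractf[symmetric]
      by (intro sum.cong) (auto simp: c_def left_diff_distrib split: if_splits)
    finally show ?thesis .
  qed
  thus ?thesis
    by blast
qed

section \<open>Counting exponent vectors of low degree\<close>

text \<open>Hoeffding's lemma for a fair sign, with \<open>h = 2 * \<bar>x\<bar>\<close> and
  \<open>p = 1 / 2\<close>; evenness of \<open>cosh\<close> allows the absolute value.\<close>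

lemma cosh_le_exp_square: "cosh (x :: real) \<le> exp (x\<^sup>2 / 2)"
proof -
  let ?y = "\<bar>x\<bar>"
  have pos: "1 + 1 / 2 * (exp (2 * ?y) - 1) > (0 :: real)"
    by (simp add: field_simps add_pos_pos)
  have "cosh x = cosh ?y"
    by (cases "x \<ge> 0") auto
  also have "\<dots> = exp (- (2 * ?y) * (1 / 2)) * (1 + 1 / 2 * (exp (2 * ?y) - 1))"
    by (simp add: cosh_field_def field_simps exp_minus flip: exp_add)
  also have "\<dots> = exp (- (2 * ?y) * (1 / 2) + ln (1 + 1 / 2 * (exp (2 * ?y) - 1)))"
    using pos by (simp only: exp_add exp_ln)
  also have "\<dots> \<le> exp ((2 * ?y)\<^sup>2 / 8)"
    using Hoeffdings_lemma_aux[of "2 * ?y" "1 / 2"] by simp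
  finally show ?thesis
    by (simp add: power_mult_distrib)
qed

text \<open>The unnormalised moment generating function of a centred uniform variable on
  \<open>{..N}\<close>. The reflection \<open>j\<close> to \<open>N - j\<close> turns
  \<open>exp\<close> into \<open>cosh\<close>.\<close>

lemma sum_exp_centered_le:
  "(\<Sum>j\<le>N. exp (c * (real N / 2 - real j))) \<le> (real N + 1) * exp (c\<^sup>2 * (real N)\<^sup>2 / 8)"
proof -
  have "(\<Sum>j\<le>N. exp (c * (real N / 2 - real j))) = (\<Sum>j\<le>N. exp (- (c * (real N / 2 - real j))))"
    by (rule sum.reindex_bij_witness[of _ "\<lambda>j. N - j" "\<lambda>j. N - j"])
      (auto simp: of_nat_diff algebra_simps)
  hence "(\<Sum>j\<le>N. exp (c * (real N / 2 - real j))) = (\<Sum>j\<le>N. cosh (c * (real N / 2 - real j)))"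
    by (simp add: cosh_field_def add_divide_distrib sum.distrib sum_divide_distrib[symmetric])
  also have "\<dots> \<le> (\<Sum>j\<le>N. exp (c\<^sup>2 * (real N)\<^sup>2 / 8))"
  proof (rule sum_mono)
    fix j assume "j \<in> {..N}"
    hence "\<bar>real N / 2 - real j\<bar> \<le> real N / 2"
      by (auto simp: abs_if)
    hence "(real N / 2 - real j)\<^sup>2 \<le> (real N / 2)\<^sup>2"
      by (simp add: abs_le_square_iff[symmetric])
    hence "c\<^sup>2 * (real N / 2 - real j)\<^sup>2 \<le> c\<^sup>2 * (real N / 2)\<^sup>2"
      by (intro mult_left_mono) auto
    thus "cosh (c * (real N / 2 - real j)) \<le> exp (c\<^sup>2 * (real N)\<^sup>2 / 8)"
      by (intro order.trans[OF cosh_le_exp_square]) (simp add: power_mult_distrib power_divide)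
  qed
  finally show ?thesis
    by (simp add: add.commute)
qed

text \<open>Chernoff's method: for independent uniform entries, the condition says that their sum
  lies at least \<open>s\<close> below its mean \<open>n * N / 2\<close>.\<close>

lemma card_low_degree_exponents_le:
  fixes N m d n :: nat
  assumes "N > 0" "d > 0" "n > 0"
  shows "real (card {e \<in> {..<n} \<rightarrow>\<^sub>E {..N}. 2 * d * (\<Sum>t<n. e t) + N * m \<le> d * N * n})
    \<le> (real N + 1) ^ n * exp (- ((real m)\<^sup>2 / (2 * (real d)\<^sup>2 * real n)))"
proof -
  let ?E = "{..<n} \<rightarrow>\<^sub>E {..N}"
  let ?L = "{e \<in> ?E. 2 * d * (\<Sum>t<n. e t) + N * m \<le> d * N * n}"
  \<comment> \<open>This \<open>c\<close> minimises the final exponent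
    \<open>- c * s + n * c^2 * N^2 / 8\<close>, with minimum
    \<open>- 2 * s^2 / (n * N^2)\<close>.\<close>
  define c where "c = 2 * real m / (real d * real n * real N)"
  define s where "s = real N * real m / (2 * real d)"
  let ?f = "\<lambda>e. exp (- (c * s)) * (\<Prod>t<n. exp (c * (real N / 2 - real (e t))))"
  have finE: "finite ?E"
    by (intro finite_PiE) auto
  have "real (card ?L) = (\<Sum>e\<in>?L. 1)"
    by simp
  also have "\<dots> \<le> (\<Sum>e\<in>?L. ?f e)"
  proof (rule sum_mono)
    fix e assume e: "e \<in> ?L"
    hence "real (2 * d * (\<Sum>t<n. e t) + N * m) \<le> real (d * N * n)"
      by (simp only: of_nat_le_iff mem_Collect_eq)
    hence "s \<le> real n * (real N / 2) - (\<Sum>t<n. real (e t))"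
      using assms by (simp add: s_def field_simps)
    hence "c * s \<le> c * (real n * (real N / 2) - (\<Sum>t<n. real (e t)))"
      by (intro mult_left_mono) (auto simp: c_def)
    also have "\<dots> = (\<Sum>t<n. c * (real N / 2 - real (e t)))"
      by (simp only: sum_distrib_left[symmetric] sum_subtractf) simp
    finally have "1 \<le> exp (- (c * s) + (\<Sum>t<n. c * (real N / 2 - real (e t))))"
      by simp
    also have "\<dots> = ?f e"
      by (simp only: exp_add exp_sum[OF finite_lessThan])
    finally show "1 \<le> ?f e" .
  qed
  also have "\<dots> \<le> (\<Sum>e\<in>?E. ?f e)"
    by (rule sum_mono2[OF finE]) (blast, simp add: prod_nonneg)
  also have "\<dots> = exp (- (c * s)) * (\<Prod>t<n. \<Sum>j\<le>N. exp (c * (real N / 2 - real j)))"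
    by (subst prod_sum_PiE) (auto simp: sum_distrib_left)
  also have "\<dots> \<le> exp (- (c * s)) * (\<Prod>t<n. (real N + 1) * exp (c\<^sup>2 * (real N)\<^sup>2 / 8))"
    by (intro mult_left_mono prod_mono) (auto intro!: sum_nonneg sum_exp_centered_le)
  also have "\<dots> = (real N + 1) ^ n * exp (- (c * s) + real n * (c\<^sup>2 * (real N)\<^sup>2 / 8))"
    by (simp only: prod_constant card_lessThan power_mult_distrib exp_add exp_of_nat_mult mult.left_commute)
  also have "- (c * s) + real n * (c\<^sup>2 * (real N)\<^sup>2 / 8) = - ((real m)\<^sup>2 / (2 * (real d)\<^sup>2 * real n))"
    using assms by (simp add: c_def s_def field_simps power2_eq_square)
  finally show ?thesis .
qed

section \<open>Sets without perfect power differences\<close>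

lemma sum_monom_power_in_polys_below:
  fixes x :: "nat \<Rightarrow> 'a :: finite_field"
  assumes "n \<ge> 1"
  shows "(\<Sum>j<Suc ((n - 1) div k). monom (x j) j) ^ k \<in> polys_below n"
proof -
  let ?b = "\<Sum>j<Suc ((n - 1) div k). monom (x j) j"
  have "degree ?b \<le> (n - 1) div k"
    by (intro degree_sum_le) (auto intro: order.trans[OF degree_monom_le])
  hence "degree ?b * k \<le> n - 1"
    by (meson div_times_less_eq_dividend le_trans mult_le_mono1)
  hence "degree (?b ^ k) \<le> n - 1"
    using degree_power_le le_trans by blast
  thus ?thesis
    using assms by (auto simp: polys_below_def intro: coeff_eq_0)
qed

lemma card_le_low_degree_exponents:
  fixes A :: "'a :: finite_field poly set"
  assumes "k \<ge> 1" "n \<ge> 1" "A \<subseteq> polys_below n" "finite A"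
    and free: "\<And>p p' b. p \<in> A \<Longrightarrow> p' \<in> A \<Longrightarrow> p - p' = b ^ k \<Longrightarrow> p = p'"
  defines "N \<equiv> CARD('a) - 1" and "m \<equiv> Suc ((n - 1) div k)" and "d \<equiv> digit_sum CARD('a) k"
  shows "card A \<le> 2 * card {e \<in> {..<n} \<rightarrow>\<^sub>E {..N}. 2 * d * (\<Sum>t<n. e t) + N * m \<le> d * N * n}"
proof -
  define L where "L = {e \<in> {..<n} \<rightarrow>\<^sub>E {..N}. 2 * d * (\<Sum>t<n. e t) + N * m \<le> d * N * n}"
  define X :: "(nat \<Rightarrow> 'a) set" where "X = {..<m} \<rightarrow>\<^sub>E UNIV"
  define B where "B x = (\<Sum>j<m. monom (x j) j)" for x :: "nat \<Rightarrow> 'a"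
  define S where "S = {..<n} \<rightarrow>\<^sub>E exponent_triples N"
  obtain c :: "nat \<times> nat \<times> nat \<Rightarrow> 'a" where c: "\<forall>u v w. 1 - (u - v - w) ^ N =
      (\<Sum>(i, j, l)\<in>exponent_triples N. c (i, j, l) * u ^ i * v ^ j * w ^ l)"
    using one_minus_power_expansion[where 'a = 'a] by blast
  \<comment> \<open>\<open>\<alpha>\<close> and \<open>\<beta>\<close> are restricted to
    \<open>{..<n}\<close> because they must lie in the extensional set \<open>L\<close>;
    \<open>\<gamma>\<close> enters only through its values below \<open>n\<close>.\<close>
  define \<alpha> where "\<alpha> \<sigma> = (\<lambda>t\<in>{..<n}. fst (\<sigma> t))" for \<sigma> :: "nat \<Rightarrow> nat \<times> nat \<times> nat"
  define \<beta> where "\<beta> \<sigma> = (\<lambda>t\<in>{..<n}. fst (snd (\<sigma> t)))" for \<sigma> :: "nat \<Rightarrow> nat \<times> nat \<times> nat"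
  define \<gamma> where "\<gamma> \<sigma> = (\<lambda>t. snd (snd (\<sigma> t)))" for \<sigma> :: "nat \<Rightarrow> nat \<times> nat \<times> nat"
  define u where "u e p = (\<Prod>t<n. coeff p t ^ e t)" for e and p :: "'a poly"
  \<comment> \<open>All dependence on \<open>x\<close> is summed into the scalar
    \<open>w \<sigma>\<close>, which is what can vanish.\<close>
  define w where "w \<sigma> = (\<Prod>t<n. c (\<sigma> t)) * (\<Sum>x\<in>X. u (\<gamma> \<sigma>) (B x ^ k))" for \<sigma>
  define K where "K p p' = (\<Sum>x\<in>X. \<Prod>t<n. 1 - (coeff p t - coeff p' t - coeff (B x ^ k) t) ^ N)"
    for p p'
  have N: "N > 0"
    using two_le_card_finite_field[where 'a = 'a] by (simp add: N_def)
  have finX: "finite X"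
    unfolding X_def by (intro finite_PiE) auto
  have finS: "finite S"
    unfolding S_def by (intro finite_PiE) (auto simp: finite_exponent_triples)
  have finL: "finite L"
    unfolding L_def by (intro finite_subset[OF _ finite_PiE[of "{..<n}" "\<lambda>_. {..N}"]]) auto

  have K_eq: "K p p' = (if p = p' then 1 else 0)" if "p \<in> A" "p' \<in> A" for p p'
  proof -
    have ind: "(\<Prod>t<n. 1 - (coeff p t - coeff p' t - coeff (B x ^ k) t) ^ N) =
        (if p - p' = B x ^ k then 1 else 0)" for x
    proof (cases "p - p' = B x ^ k")
      case True
      hence "coeff p t - coeff p' t - coeff (B x ^ k) t = 0" for t
        by (simp flip: True)
      thus ?thesis
        using True N by (simp add: power_0_left)
    next
      case False
      have "B x ^ k \<in> polys_below n"
        unfolding B_def m_def using assms by (intro sum_monom_power_in_polys_below)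
      moreover have "p \<in> polys_below n" "p' \<in> polys_below n"
        using that assms by auto
      \<comment> \<open>Both sides have no coefficients from \<open>n\<close> on, so a difference
        shows up at some \<open>t < n\<close>; that factor vanishes because nonzero elements have
        \<open>N\<close>-th power 1.\<close>
      ultimately have "\<exists>t<n. coeff (p - p') t \<noteq> coeff (B x ^ k) t"
        using False by (auto simp: polys_below_def poly_eq_iff) (metis diff_0_right leI)
      then obtain t where t: "t < n" "coeff p t - coeff p' t - coeff (B x ^ k) t \<noteq> 0"
        by auto
      hence "1 - (coeff p t - coeff p' t - coeff (B x ^ k) t) ^ N = 0"
        unfolding N_def by (subst finite_field_power_card_minus_one) auto
      thus ?thesis
        using False t by (auto intro!: prod_zero)
    qed
    show ?thesis
    proof (cases "p = p'")
      case True
      \<comment> \<open>On the diagonal exactly one \<open>x\<close> contributes, so the entry is 1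
        in the field and not an uncontrolled count.\<close>
      have "B x ^ k = 0 \<longleftrightarrow> x = (\<lambda>j\<in>{..<m}. 0)" if "x \<in> X" for x
      proof -
        have "coeff (B x) j = x j" if "j < m" for j
          using that by (simp add: B_def coeff_sum)
        hence "B x = 0 \<longleftrightarrow> (\<forall>j<m. x j = 0)"
          by (auto simp: B_def)
        also have "\<dots> \<longleftrightarrow> x = (\<lambda>j\<in>{..<m}. 0)"
          using that by (auto simp: X_def fun_eq_iff PiE_def extensional_def)
        finally show ?thesis
          using \<open>k \<ge> 1\<close> by simp
      qed
      hence "K p p' = (\<Sum>x\<in>X. if x = (\<lambda>j\<in>{..<m}. 0) then 1 else 0)"
        unfolding K_def ind using True by (intro sum.cong) auto
      also have "\<dots> = 1"
        using finX by (simp add: X_def)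
      finally show ?thesis
        using True by simp
    next
      case False
      hence "p - p' \<noteq> B x ^ k" for x
        using free[OF that] by blast
      thus ?thesis
        using False by (simp add: K_def ind)
    qed
  qed

  have K_expand: "K p p' = (\<Sum>\<sigma>\<in>S. w \<sigma> * u (\<alpha> \<sigma>) p * u (\<beta> \<sigma>) p')" for p p'
  proof -
    have "(\<Prod>t<n. 1 - (coeff p t - coeff p' t - coeff (B x ^ k) t) ^ N) =
       (\<Sum>\<sigma>\<in>S. (\<Prod>t<n. c (\<sigma> t)) * u (\<gamma> \<sigma>) (B x ^ k) * u (\<alpha> \<sigma>) p * u (\<beta> \<sigma>) p')" for x
    proof -
      have "(\<Prod>t<n. 1 - (coeff p t - coeff p' t - coeff (B x ^ k) t) ^ N) =
         (\<Sum>\<sigma>\<in>S. \<Prod>t<n. case \<sigma> t of (i, j, l) \<Rightarrow>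
            c (i, j, l) * coeff p t ^ i * coeff p' t ^ j * coeff (B x ^ k) t ^ l)"
        unfolding c[rule_format] S_def by (subst prod_sum_PiE) (auto simp: finite_exponent_triples)
      also have "\<dots> = (\<Sum>\<sigma>\<in>S. (\<Prod>t<n. c (\<sigma> t)) * u (\<gamma> \<sigma>) (B x ^ k) * u (\<alpha> \<sigma>) p * u (\<beta> \<sigma>) p')"
        unfolding u_def prod.distrib[symmetric]
        by (intro sum.cong prod.cong)
          (auto simp: \<alpha>_def \<beta>_def \<gamma>_def case_prod_beta mult_ac)
      finally show ?thesis .
    qed
    hence "K p p' = (\<Sum>x\<in>X. \<Sum>\<sigma>\<in>S. (\<Prod>t<n. c (\<sigma> t)) * u (\<gamma> \<sigma>) (B x ^ k) * u (\<alpha> \<sigma>) p * u (\<beta> \<sigma>) p')"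
      by (simp add: K_def)
    also have "\<dots> = (\<Sum>\<sigma>\<in>S. w \<sigma> * u (\<alpha> \<sigma>) p * u (\<beta> \<sigma>) p')"
      by (subst sum.swap) (simp add: w_def sum_distrib_left sum_distrib_right)
    finally show ?thesis .
  qed

  have low: "\<alpha> \<sigma> \<in> L \<or> \<beta> \<sigma> \<in> L" if "\<sigma> \<in> S" "w \<sigma> \<noteq> 0" for \<sigma>
  proof -
    have triple: "\<alpha> \<sigma> t + \<beta> \<sigma> t + \<gamma> \<sigma> t \<le> N" if "t < n" for t
    proof -
      have "\<sigma> t \<in> exponent_triples N"
        using \<open>\<sigma> \<in> S\<close> that by (auto simp: S_def)
      thus ?thesis
        using that by (auto simp: exponent_triples_def \<alpha>_def \<beta>_def \<gamma>_def)
    qed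
    have "poly_fun m (\<Sum>t<n. d * \<gamma> \<sigma> t) (\<lambda>x. u (\<gamma> \<sigma>) (B x ^ k))"
      unfolding u_def B_def d_def
      by (intro poly_fun_prod poly_fun_power poly_fun_coeff_power_digit_sum)
    moreover have "(\<Sum>x\<in>X. u (\<gamma> \<sigma>) (B x ^ k)) \<noteq> 0"
      using that by (auto simp: w_def)
    \<comment> \<open>A nonzero weight means a nonvanishing sum over \<open>X\<close>, which forces
      the degree up to at least \<open>(q - 1) * m\<close>.\<close>
    ultimately have "N * m \<le> (\<Sum>t<n. d * \<gamma> \<sigma> t)"
      unfolding X_def N_def using sum_poly_fun_eq_0 not_le by blast
    hence "N * m \<le> d * (\<Sum>t<n. \<gamma> \<sigma> t)"
      by (simp add: sum_distrib_left)
    moreover have "(\<Sum>t<n. \<alpha> \<sigma> t) + (\<Sum>t<n. \<beta> \<sigma> t) + (\<Sum>t<n. \<gamma> \<sigma> t) \<le> N * n"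
      using sum_mono[of "{..<n}", OF triple] by (simp add: sum.distrib mult.commute)
    hence "d * ((\<Sum>t<n. \<alpha> \<sigma> t) + (\<Sum>t<n. \<beta> \<sigma> t) + (\<Sum>t<n. \<gamma> \<sigma> t)) \<le> d * (N * n)"
      by (rule mult_left_mono) simp
    \<comment> \<open>The degrees of \<open>\<alpha> \<sigma>\<close> and
      \<open>\<beta> \<sigma>\<close>, scaled by \<open>d\<close>, sum to at most
      \<open>d * N * n - N * m\<close>, so the smaller is at most half of this.\<close>
    ultimately have "2 * (d * (\<Sum>t<n. \<alpha> \<sigma> t)) + N * m \<le> d * (N * n) \<or>
        2 * (d * (\<Sum>t<n. \<beta> \<sigma> t)) + N * m \<le> d * (N * n)"
      unfolding distrib_left by linarith
    moreover have "\<alpha> \<sigma> \<in> {..<n} \<rightarrow>\<^sub>E {..N}"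
    proof (rule PiE_I)
      show "\<alpha> \<sigma> t \<in> {..N}" if "t \<in> {..<n}" for t
        using triple[of t] that by simp
    qed (auto simp: \<alpha>_def)
    moreover have "\<beta> \<sigma> \<in> {..<n} \<rightarrow>\<^sub>E {..N}"
    proof (rule PiE_I)
      show "\<beta> \<sigma> t \<in> {..N}" if "t \<in> {..<n}" for t
        using triple[of t] that by simp
    qed (auto simp: \<beta>_def)
    ultimately show ?thesis
      by (auto simp: L_def mult.assoc)
  qed

  show ?thesis
    unfolding L_def[symmetric]
    by (rule card_le_of_low_rank_terms[OF \<open>finite A\<close> finL finS low, where u = u])
      (use K_eq in \<open>auto simp: K_expand\<close>)
qed

theorem theorem1p1:
  fixes A :: "'a :: finite_field poly set"
    and k q n :: nat
  assumes "k \<ge> 2"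
    and "q = CARD('a)"
    and "n \<ge> 1"
    and "A \<subseteq> polys_below n"
    and "real (card A) > 2 * real q powr ((1 - c_exponent k q) * real n)"
  shows "\<exists>p\<in>A. \<exists>p'\<in>A. p \<noteq> p' \<and> (\<exists>b :: 'a poly. p - p' = b ^ k)"
proof (rule ccontr)
  assume "\<not> ?thesis"
  hence free: "p = p'" if "p \<in> A" "p' \<in> A" "p - p' = b ^ k" for p p' b
    using that by blast
  define N where "N = q - 1"
  define m where "m = Suc ((n - 1) div k)"
  define d where "d = digit_sum q k"
  have q: "q \<ge> 2"
    using assms(2) two_le_card_finite_field[where 'a = 'a] by simp
  have d: "d > 0"
    using digit_sum_pos[OF q] assms(1) by (simp add: d_def)
  \<comment> \<open>An infinite set has \<open>card\<close> 0, against the positive lower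
    bound.\<close>
  have "finite A"
  proof (rule ccontr)
    assume "infinite A"
    thus False
      using assms(5) by (simp add: not_less)
  qed
  \<comment> \<open>Rounding in \<open>m\<close> goes the right way: \<open>m \<ge> n / k\<close>
    even if \<open>k\<close> does not divide \<open>n\<close>.\<close>
  have "n - 1 < m * k"
    using assms(1) dividend_less_div_times[of k "n - 1"] by (simp add: m_def)
  hence "real n \<le> real (m * k)"
    using assms(3) by (intro of_nat_mono) linarith
  hence "(real n)\<^sup>2 \<le> (real m * real k)\<^sup>2"
    by (intro power_mono) auto
  hence exponent: "real n / (2 * (real k)\<^sup>2 * (real d)\<^sup>2) \<le> (real m)\<^sup>2 / (2 * (real d)\<^sup>2 * real n)"
    using assms(1,3) d by (simp add: field_simps power2_eq_square)
  have "card A \<le> 2 * card {e \<in> {..<n} \<rightarrow>\<^sub>E {..N}. 2 * d * (\<Sum>t<n. e t) + N * m \<le> d * N * n}"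
    unfolding N_def m_def d_def assms(2)
    by (rule card_le_low_degree_exponents) (use assms(1,3,4) \<open>finite A\<close> free in auto)
  hence "real (card A) \<le>
      2 * real (card {e \<in> {..<n} \<rightarrow>\<^sub>E {..N}. 2 * d * (\<Sum>t<n. e t) + N * m \<le> d * N * n})"
    by linarith
  also have "\<dots> \<le> 2 * ((real N + 1) ^ n * exp (- ((real m)\<^sup>2 / (2 * (real d)\<^sup>2 * real n))))"
    using q d assms(3) by (intro mult_left_mono card_low_degree_exponents_le) (auto simp: N_def)
  also have "\<dots> \<le> 2 * (real q ^ n * exp (- (real n / (2 * (real k)\<^sup>2 * (real d)\<^sup>2))))"
    using q exponent by (intro mult_left_mono mult_mono) (auto simp: N_def of_nat_diff)
  also have "real q ^ n * exp (- (real n / (2 * (real k)\<^sup>2 * (real d)\<^sup>2))) =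
      real q powr ((1 - c_exponent k q) * real n)"
  proof -
    \<comment> \<open>The factor \<open>ln q\<close> in \<open>c_exponent\<close> converts the
      natural exponential into a power of \<open>q\<close>.\<close>
    have "c_exponent k q * ln (real q) = 1 / (2 * (real k)\<^sup>2 * (real d)\<^sup>2)"
    proof -
      have "inverse (x * l) * l = 1 / x" if "l \<noteq> 0" for x l :: real
        using that by (simp add: field_simps)
      moreover have "ln (real q) \<noteq> 0"
        using q by simp
      ultimately show ?thesis
        unfolding c_exponent_def d_def by blast
    qed
    moreover have "(1 - c_exponent k q) * real n * ln (real q) =
        real n * ln (real q) - real n * (c_exponent k q * ln (real q))"
      by (simp only: algebra_simps)
    ultimately have "(1 - c_exponent k q) * real n * ln (real q) =
        real n * ln (real q) + - (real n / (2 * (real k)\<^sup>2 * (real d)\<^sup>2))"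
      by simp
    thus ?thesis
      using q by (simp only: powr_def exp_add exp_of_nat_mult) simp
  qed
  finally show False
    using assms(5) by simp
qed

end
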